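(* Let $d\ge 1$ and let $\mathcal{A}_2$ be the (second) arcsine transformation of measures on $\mathbb{R}^d$, with domain $\mathfrak{D}(\mathcal{A}_2)$. Then $\mathfrak{D}(\mathcal{A}_2)=\mathfrak{M}_L(\mathbb{R}^d)$.
   Context: $\mathfrak{M}_L(\mathbb{R}^d)$ is the class of Lévy measures on $\mathbb{R}^d$: measures $\nu$ with $\nu(\{0\})=0$ and $\int_{\mathbb{R}^d}(1\wedge|x|^2)\,\nu(\mathrm{d}x)<\infty$. For $s>0$ let $a_2(r;s)=2\pi^{-1}(s^2-r^2)^{-1/2}1_{(0,s)}(r)$. For a measure $\nu$ on $\mathbb{R}^d$ define $$\mathcal{A}_2(\nu)(B)=\int_{\mathbb{R}^d\setminus\{0\}}\nu(\mathrm{d}x)\int_0^\infty a_2(r;|x|)\,1_B\!\left(r\frac{x}{|x|}\right)\mathrm{d}r,\qquad B\in\mathcal{B}(\mathbb{R}^d).$$ The domain $\mathfrak{D}(\mathcal{A}_2)$ is the class of measures $\nu$ on $\mathbb{R}^d$ such that $\nu(\{0\})=0$ and the right-hand side, as a function of $B$, is a measure belonging to $\mathfrak{M}_L(\mathbb{R}^d)$. *)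

theory Defs
  imports "HOL-Analysis.Analysis"
begin

text \<open>
  Measures on $\mathbb{R}^d$ are Borel measures with values in $[0,\infty]$, with no finiteness
  assumption built in, and $|x|$ is the Euclidean norm.
\<close>

definition levy_measures :: "(real ^ 'd) measure set" where
  "levy_measures = {\<nu>. sets \<nu> = sets borel \<and> emeasure \<nu> {0} = 0
     \<and> (\<integral>\<^sup>+x. ennreal (min 1 ((norm x)\<^sup>2)) \<partial>\<nu>) < \<infinity>}"

definition a2 :: "real \<Rightarrow> real \<Rightarrow> real" where
  "a2 r s = 2 / pi * (s\<^sup>2 - r\<^sup>2) powr (- 1 / 2) * indicator {0<..<s} r"

text \<open>
  The right-hand side of the defining formula, as a bare set function. The integrands are
  nonnegative, so the integrals are taken in $[0,\infty]$.
\<close>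

definition arcsine2_fun :: "(real ^ 'd) measure \<Rightarrow> (real ^ 'd) set \<Rightarrow> ennreal" where
  "arcsine2_fun \<nu> B =
     (\<integral>\<^sup>+x\<in>- {0}.
        (\<integral>\<^sup>+r\<in>{0<..}. ennreal (a2 r (norm x)) * indicator B (r *\<^sub>R (x /\<^sub>R norm x)) \<partial>lborel) \<partial>\<nu>)"

text \<open>
  \<open>measure_of\<close> yields the zero measure when the given set function is not a measure, so
  the domain below has to require the measure property separately.
\<close>

definition arcsine2 :: "(real ^ 'd) measure \<Rightarrow> (real ^ 'd) measure" where
  "arcsine2 \<nu> = measure_of UNIV (sets borel) (arcsine2_fun \<nu>)"

definition arcsine2_domain :: "(real ^ 'd) measure set" where
  "arcsine2_domain = {\<nu>. sets \<nu> = sets borel \<and> emeasure \<nu> {0} = 0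
     \<and> measure_space UNIV (sets borel) (arcsine2_fun \<nu>) \<and> arcsine2 \<nu> \<in> levy_measures}"

lemma sets_arcsine2 [simp]: "sets (arcsine2 \<nu>) = sets borel"
  unfolding arcsine2_def by (metis sets.sigma_sets_eq sets_measure_of_conv space_borel subset_Pow_Union
      Pow_UNIV top_greatest)

lemma emeasure_arcsine2:
  assumes "measure_space UNIV (sets borel) (arcsine2_fun \<nu>)" and "B \<in> sets borel"
  shows "emeasure (arcsine2 \<nu>) B = arcsine2_fun \<nu> B"
  using assms unfolding arcsine2_def measure_space_def
  by (intro emeasure_measure_of_sigma) auto

end

theory Submission
  imports Defs
begin

text \<open>
  Write \<open>\<kappa>\<^sub>x\<close> for the arcsine law on the segment from the origin to \<open>x\<close>: the law of \<open>r x / |x|\<close>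
  where \<open>r\<close> has density \<open>a\<^sub>2(\<cdot>; |x|)\<close>. The transformation integrates this kernel against \<open>\<nu>\<close>, so
  it always yields a measure, and integrals against that measure are iterated integrals, first
  against \<open>\<kappa>\<^sub>x\<close> and then against \<open>\<nu>\<close>. As \<open>\<nu>\<close> may fail to be \<open>\<sigma>\<close>-finite, this is not an instance
  of Fubini's theorem; instead, measurability of \<open>x \<mapsto> \<kappa>\<^sub>x(B)\<close> comes from the \<open>\<sigma>\<close>-finiteness of
  Lebesgue measure, and the rest is monotone convergence (\<open>mixture_measure_space\<close>,
  \<open>nn_integral_mixture\<close>).

  Hence everything reduces to comparing \<open>\<integral> (1 \<and> |y|\<^sup>2) \<kappa>\<^sub>x(dy)\<close> with \<open>1 \<and> |x|\<^sup>2\<close>. The former is at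
  most the latter, since \<open>\<kappa>\<^sub>x\<close> has mass at most one (the antiderivative of its density is an
  arcsine) and lives on \<open>|y| < |x|\<close>. Conversely the density is at least \<open>2 / (\<pi> |x|)\<close>, so
  \<open>\<kappa>\<^sub>x\<close> gives mass at least \<open>1 / \<pi>\<close> to the outer half \<open>|y| > |x| / 2\<close>, where
  \<open>1 \<and> |y|\<^sup>2 \<ge> (1 \<and> |x|\<^sup>2) / 4\<close>. So \<open>1 \<and> |\<cdot>|\<^sup>2\<close> is integrable against \<open>\<nu>\<close> exactly when it is
  integrable against the transform of \<open>\<nu>\<close>.
\<close>

section \<open>Mixtures of a kernel of measures\<close>

lemma mixture_measure_space:
  fixes K :: "'a \<Rightarrow> 'b measure"
  assumes sets: "\<And>x. sets (K x) = sets N"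
    and meas: "\<And>B. B \<in> sets N \<Longrightarrow> (\<lambda>x. emeasure (K x) B) \<in> borel_measurable M"
  shows "measure_space (space N) (sets N) (\<lambda>B. \<integral>\<^sup>+x. emeasure (K x) B \<partial>M)"
  unfolding measure_space_def
proof (intro conjI)
  show "sigma_algebra (space N) (sets N)"
    by (rule sets.sigma_algebra_axioms)
  show "positive (sets N) (\<lambda>B. \<integral>\<^sup>+x. emeasure (K x) B \<partial>M)"
    by (simp add: positive_def)
  show "countably_additive (sets N) (\<lambda>B. \<integral>\<^sup>+x. emeasure (K x) B \<partial>M)"
  proof (rule countably_additiveI)
    fix A :: "nat \<Rightarrow> 'b set"
    assume A: "range A \<subseteq> sets N" "disjoint_family A"
    have "(\<Sum>i. \<integral>\<^sup>+x. emeasure (K x) (A i) \<partial>M) = (\<integral>\<^sup>+x. (\<Sum>i. emeasure (K x) (A i)) \<partial>M)"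
      using A by (intro nn_integral_suminf[symmetric] meas) auto
    also have "\<dots> = (\<integral>\<^sup>+x. emeasure (K x) (\<Union>i. A i) \<partial>M)"
      using A by (simp add: suminf_emeasure sets)
    finally show "(\<Sum>i. \<integral>\<^sup>+x. emeasure (K x) (A i) \<partial>M) = (\<integral>\<^sup>+x. emeasure (K x) (\<Union>i. A i) \<partial>M)" .
  qed
qed

text \<open>
  The measurability claim is proved together with the identity because the induction over \<open>f\<close>
  uses it, for the functions already treated, to exchange the outer integral with sums and
  suprema.
\<close>

lemma nn_integral_mixture:
  fixes K :: "'a \<Rightarrow> 'b measure"
  assumes sets: "\<And>x. sets (K x) = sets N"
    and meas: "\<And>B. B \<in> sets N \<Longrightarrow> (\<lambda>x. emeasure (K x) B) \<in> borel_measurable M"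
    and em: "\<And>B. B \<in> sets N \<Longrightarrow> emeasure N B = (\<integral>\<^sup>+x. emeasure (K x) B \<partial>M)"
    and f: "f \<in> borel_measurable N"
  shows "(\<lambda>x. \<integral>\<^sup>+y. f y \<partial>K x) \<in> borel_measurable M
    \<and> (\<integral>\<^sup>+y. f y \<partial>N) = (\<integral>\<^sup>+x. (\<integral>\<^sup>+y. f y \<partial>K x) \<partial>M)"
  using f
proof (induction f rule: borel_measurable_induct)
  case (cong f g)
  have sp: "space (K x) = space N" for x
    using sets by (rule sets_eq_imp_space_eq)
  have "(\<integral>\<^sup>+y. f y \<partial>K x) = (\<integral>\<^sup>+y. g y \<partial>K x)" for x
    using cong(3) by (intro nn_integral_cong) (simp add: sp)
  moreover have "(\<integral>\<^sup>+y. f y \<partial>N) = (\<integral>\<^sup>+y. g y \<partial>N)"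
    using cong(3) by (intro nn_integral_cong)
  ultimately show ?case
    using cong(4) by simp
next
  case (set A)
  then show ?case
    using meas[of A] em[of A] by (simp add: sets)
next
  case (mult u c)
  then have "u \<in> borel_measurable (K x)" for x
    by (simp add: measurable_cong_sets[OF sets])
  then show ?case
    using mult by (auto simp: nn_integral_cmult intro!: borel_measurable_times_ennreal)
next
  case (add u v)
  then have "u \<in> borel_measurable (K x)" "v \<in> borel_measurable (K x)" for x
    by (simp_all add: measurable_cong_sets[OF sets])
  then show ?case
    using add by (auto simp: nn_integral_add intro!: borel_measurable_add)
next
  case (seq U)
  have inc_U: "incseq U"
    using seq by simp
  have UK: "U i \<in> borel_measurable (K x)" for i x
    using seq.hyps(1) by (simp add: measurable_cong_sets[OF sets])
  have U: "(\<integral>\<^sup>+y. (SUP i. U i) y \<partial>K x) = (SUP i. \<integral>\<^sup>+y. U i y \<partial>K x)" for x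
    unfolding SUP_apply by (rule nn_integral_monotone_convergence_SUP[OF inc_U UK])
  have inc: "incseq (\<lambda>i x. \<integral>\<^sup>+y. U i y \<partial>K x)"
    using inc_U by (auto simp: incseq_def le_fun_def intro!: nn_integral_mono)
  have "(\<integral>\<^sup>+y. (SUP i. U i) y \<partial>N) = (SUP i. \<integral>\<^sup>+y. U i y \<partial>N)"
    unfolding SUP_apply by (rule nn_integral_monotone_convergence_SUP[OF inc_U seq.hyps(1)])
  also have "\<dots> = (SUP i. \<integral>\<^sup>+x. (\<integral>\<^sup>+y. U i y \<partial>K x) \<partial>M)"
    using seq.IH by simp
  also have "\<dots> = (\<integral>\<^sup>+x. (SUP i. \<integral>\<^sup>+y. U i y \<partial>K x) \<partial>M)"
    using seq.IH by (intro nn_integral_monotone_convergence_SUP[symmetric] inc) simp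
  finally have "(\<integral>\<^sup>+y. (SUP i. U i) y \<partial>N) = (\<integral>\<^sup>+x. (SUP i. \<integral>\<^sup>+y. U i y \<partial>K x) \<partial>M)" .
  moreover have "(\<lambda>x. SUP i. \<integral>\<^sup>+y. U i y \<partial>K x) \<in> borel_measurable M"
    using seq.IH by (intro borel_measurable_SUP) auto
  ultimately show ?case
    by (simp only: U)
qed

section \<open>The arcsine kernel\<close>

text \<open>
  For \<open>x = 0\<close> the density vanishes identically, so the kernel is the zero measure there; this
  is why the mixture may run over the whole space although the transformation integrates over
  \<open>x \<noteq> 0\<close> only. The junk value of \<open>x /\<^sub>R norm x\<close> at the origin is harmless for the same reason.
\<close>

definition arcsine_kernel :: "real ^ 'd \<Rightarrow> (real ^ 'd) measure" where
  "arcsine_kernel x =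
     distr (density lborel (\<lambda>r. ennreal (a2 r (norm x)))) borel (\<lambda>r. r *\<^sub>R (x /\<^sub>R norm x))"

lemma sets_arcsine_kernel [simp]: "sets (arcsine_kernel x) = sets borel"
  by (simp add: arcsine_kernel_def)

lemma a2_measurable [measurable]: "(\<lambda>(r, s). a2 r s) \<in> borel_measurable (borel \<Otimes>\<^sub>M borel)"
proof -
  have "(\<lambda>(r, s). 2 / pi * (s\<^sup>2 - r\<^sup>2) powr (- 1 / 2) * (if 0 < r \<and> r < s then 1 else 0 :: real))
      \<in> borel_measurable (borel \<Otimes>\<^sub>M borel)"
    by measurable
  then show ?thesis
    by (rule back_subst[of "\<lambda>f. f \<in> _"]) (auto simp: a2_def indicator_def fun_eq_iff)
qed

lemma a2_nonneg: "0 \<le> a2 r s"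
  by (simp add: a2_def indicator_def)

lemma a2_eq_0: "r \<notin> {0<..<s} \<Longrightarrow> a2 r s = 0"
  by (simp add: a2_def)

lemma nn_integral_arcsine_kernel:
  assumes [measurable]: "f \<in> borel_measurable borel"
  shows "(\<integral>\<^sup>+y. f y \<partial>arcsine_kernel x) =
    (\<integral>\<^sup>+r. ennreal (a2 r (norm x)) * f (r *\<^sub>R (x /\<^sub>R norm x)) \<partial>lborel)"
  unfolding arcsine_kernel_def by (simp add: nn_integral_distr nn_integral_density)

lemma emeasure_arcsine_kernel:
  assumes [measurable]: "B \<in> sets borel"
  shows "emeasure (arcsine_kernel x) B =
    (\<integral>\<^sup>+r. ennreal (a2 r (norm x)) * indicator B (r *\<^sub>R (x /\<^sub>R norm x)) \<partial>lborel)"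
proof -
  have "emeasure (arcsine_kernel x) B = (\<integral>\<^sup>+y. indicator B y \<partial>arcsine_kernel x)"
    by simp
  then show ?thesis
    by (simp only: nn_integral_arcsine_kernel borel_measurable_indicator assms)
qed

lemma arcsine_kernel_measurable:
  assumes \<nu>: "sets \<nu> = sets borel" and [measurable]: "B \<in> sets borel"
  shows "(\<lambda>x. emeasure (arcsine_kernel x) B) \<in> borel_measurable \<nu>"
  unfolding emeasure_arcsine_kernel[OF assms(2)] measurable_cong_sets[OF \<nu> refl]
  by measurable

lemma arcsine2_fun_eq_mixture:
  assumes "B \<in> sets borel"
  shows "arcsine2_fun \<nu> B = (\<integral>\<^sup>+x. emeasure (arcsine_kernel x) B \<partial>\<nu>)"
  unfolding arcsine2_fun_def emeasure_arcsine_kernel[OF assms]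
proof (rule nn_integral_cong)
  fix x
  have "ennreal (a2 r (norm x)) * indicator B (r *\<^sub>R (x /\<^sub>R norm x)) * indicator {0<..} r =
      ennreal (a2 r (norm x)) * indicator B (r *\<^sub>R (x /\<^sub>R norm x))" for r
    by (cases "0 < r") (simp_all add: a2_eq_0)
  moreover have "a2 r 0 = 0" for r
    by (simp add: a2_eq_0)
  ultimately show "(\<integral>\<^sup>+r\<in>{0<..}. ennreal (a2 r (norm x)) *
        indicator B (r *\<^sub>R (x /\<^sub>R norm x)) \<partial>lborel) * indicator (- {0}) x =
      (\<integral>\<^sup>+r. ennreal (a2 r (norm x)) * indicator B (r *\<^sub>R (x /\<^sub>R norm x)) \<partial>lborel)"
    by (cases "x = 0") simp_all
qed

lemma measure_space_arcsine2_fun: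
  assumes \<nu>: "sets \<nu> = sets borel"
  shows "measure_space UNIV (sets borel) (arcsine2_fun \<nu>)"
proof -
  have "measure_space (space borel) (sets borel) (\<lambda>B. \<integral>\<^sup>+x. emeasure (arcsine_kernel x) B \<partial>\<nu>)"
    using arcsine_kernel_measurable[OF \<nu>] by (intro mixture_measure_space) auto
  then show ?thesis
    using measure_space_eq[of "sets borel" UNIV "arcsine2_fun \<nu>"
        "\<lambda>B. \<integral>\<^sup>+x. emeasure (arcsine_kernel x) B \<partial>\<nu>"]
    by (simp add: sets.sigma_sets_eq[of borel, simplified] arcsine2_fun_eq_mixture)
qed

lemma nn_integral_arcsine2:
  assumes \<nu>: "sets \<nu> = sets borel" and f: "f \<in> borel_measurable borel"
  shows "(\<integral>\<^sup>+y. f y \<partial>arcsine2 \<nu>) = (\<integral>\<^sup>+x. (\<integral>\<^sup>+y. f y \<partial>arcsine_kernel x) \<partial>\<nu>)"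
  using f arcsine_kernel_measurable[OF \<nu>]
  by (intro nn_integral_mixture[THEN conjunct2])
    (auto simp: emeasure_arcsine2[OF measure_space_arcsine2_fun[OF \<nu>]] arcsine2_fun_eq_mixture
      measurable_cong_sets[OF sets_arcsine2 refl])

text \<open>No kernel charges the origin, because the radius is positive wherever its density is.\<close>

lemma emeasure_arcsine2_origin:
  fixes \<nu> :: "(real ^ 'd) measure"
  assumes \<nu>: "sets \<nu> = sets borel"
  shows "emeasure (arcsine2 \<nu>) {0} = 0"
proof -
  have "emeasure (arcsine_kernel x) {0} = 0" for x :: "real ^ 'd"
  proof -
    have "ennreal (a2 r (norm x)) * indicator {0} (r *\<^sub>R (x /\<^sub>R norm x)) = 0" for r
      by (auto simp: a2_def indicator_def)
    then show ?thesis
      by (simp add: emeasure_arcsine_kernel del: mult_eq_0_iff)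
  qed
  then show ?thesis
    by (simp add: emeasure_arcsine2[OF measure_space_arcsine2_fun[OF \<nu>]] arcsine2_fun_eq_mixture)
qed

section \<open>Comparison of truncated second moments\<close>

text \<open>
  The density is unbounded near \<open>s\<close>, but its antiderivative \<open>2 / \<pi> \<cdot> arcsin (r / s)\<close> is continuous
  up to the endpoint, which suffices for the fundamental theorem of calculus.
\<close>

lemma nn_integral_a2_le_1: "(\<integral>\<^sup>+r. ennreal (a2 r s) \<partial>lborel) \<le> 1"
proof (cases "0 < s")
  case True
  have "((\<lambda>r. a2 r s) has_integral 2 / pi * arcsin (s / s) - 2 / pi * arcsin (0 / s)) {0..s}"
  proof (rule fundamental_theorem_of_calculus_interior)
    show "0 \<le> s" using True by simp
    show "continuous_on {0..s} (\<lambda>r. 2 / pi * arcsin (r / s))"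
      using True by (intro continuous_intros) (auto simp: field_simps)
    fix r assume r: "r \<in> {0<..<s}"
    then have rs: "- 1 < r / s" "r / s < 1" and sr: "0 < s\<^sup>2 - r\<^sup>2"
      by (auto simp: field_simps power_strict_mono)
    have "sqrt (1 - (r / s)\<^sup>2) = sqrt ((s\<^sup>2 - r\<^sup>2) / s\<^sup>2)"
      using True by (simp add: field_simps)
    also have "\<dots> = sqrt (s\<^sup>2 - r\<^sup>2) / s"
      using True by (simp add: real_sqrt_divide)
    finally have "inverse (sqrt (1 - (r / s)\<^sup>2)) * (1 / s) = (s\<^sup>2 - r\<^sup>2) powr (- 1 / 2)"
      using True sr by (simp add: powr_minus powr_half_sqrt field_simps)
    moreover have "((\<lambda>r. 2 / pi * arcsin (r / s)) has_real_derivative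
        2 / pi * (inverse (sqrt (1 - (r / s)\<^sup>2)) * (1 / s))) (at r)"
      using rs True by (auto intro!: derivative_eq_intros simp: field_simps)
    ultimately have "((\<lambda>r. 2 / pi * arcsin (r / s)) has_real_derivative a2 r s) (at r)"
      using r by (simp add: a2_def)
    then show "((\<lambda>r. 2 / pi * arcsin (r / s)) has_vector_derivative a2 r s) (at r)"
      by (simp add: has_real_derivative_iff_has_vector_derivative)
  qed
  then have "((\<lambda>r. a2 r s) has_integral 1) {0..s}"
    using True by simp
  then have "((\<lambda>r. a2 r s) has_integral 1) UNIV"
    by (rule has_integral_on_superset) (auto simp: a2_def)
  then show ?thesis
    by (subst nn_integral_has_integral_lborel) (auto simp: a2_nonneg)
next
  case False
  then show ?thesis
    by (simp add: a2_def)
qed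

lemma truncated_square_measurable [measurable]:
  "(\<lambda>y :: real ^ 'd. ennreal (min 1 ((norm y)\<^sup>2))) \<in> borel_measurable borel"
  by measurable

lemma arcsine_kernel_truncated_square:
  fixes x :: "real ^ 'd"
  shows "(\<integral>\<^sup>+y. ennreal (min 1 ((norm y)\<^sup>2)) \<partial>arcsine_kernel x) =
    (\<integral>\<^sup>+r. ennreal (a2 r (norm x)) * ennreal (min 1 (r\<^sup>2)) \<partial>lborel)"
proof -
  have "ennreal (a2 r (norm x)) * ennreal (min 1 ((norm (r *\<^sub>R (x /\<^sub>R norm x)))\<^sup>2)) =
      ennreal (a2 r (norm x)) * ennreal (min 1 (r\<^sup>2))" for r
    by (cases "x = 0") (simp_all add: a2_eq_0 abs_mult mult.assoc)
  then show ?thesis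
    by (simp only: nn_integral_arcsine_kernel truncated_square_measurable)
qed

lemma arcsine_kernel_truncated_square_le:
  fixes x :: "real ^ 'd"
  shows "(\<integral>\<^sup>+y. ennreal (min 1 ((norm y)\<^sup>2)) \<partial>arcsine_kernel x) \<le> ennreal (min 1 ((norm x)\<^sup>2))"
proof -
  have "ennreal (a2 r (norm x)) * ennreal (min 1 (r\<^sup>2))
      \<le> ennreal (min 1 ((norm x)\<^sup>2)) * ennreal (a2 r (norm x))" for r
  proof (cases "r \<in> {0<..<norm x}")
    case True
    then have "r\<^sup>2 \<le> (norm x)\<^sup>2"
      by (intro power_mono) auto
    then show ?thesis
      by (subst mult.commute) (intro mult_right_mono ennreal_leI, auto)
  next
    case False
    then show ?thesis by (simp add: a2_eq_0)
  qed
  then have "(\<integral>\<^sup>+y. ennreal (min 1 ((norm y)\<^sup>2)) \<partial>arcsine_kernel x)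
      \<le> (\<integral>\<^sup>+r. ennreal (min 1 ((norm x)\<^sup>2)) * ennreal (a2 r (norm x)) \<partial>lborel)"
    unfolding arcsine_kernel_truncated_square by (intro nn_integral_mono)
  also have "\<dots> = ennreal (min 1 ((norm x)\<^sup>2)) * (\<integral>\<^sup>+r. ennreal (a2 r (norm x)) \<partial>lborel)"
    by (intro nn_integral_cmult) measurable
  also have "\<dots> \<le> ennreal (min 1 ((norm x)\<^sup>2)) * 1"
    by (intro mult_left_mono nn_integral_a2_le_1) simp
  finally show ?thesis by simp
qed

lemma a2_ge:
  assumes "0 < r" "r < s"
  shows "2 / (pi * s) \<le> a2 r s"
proof -
  have pos: "0 < s\<^sup>2 - r\<^sup>2"
    using assms by (simp add: power_strict_mono)
  have "sqrt (s\<^sup>2 - r\<^sup>2) \<le> sqrt (s\<^sup>2)"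
    by (intro real_sqrt_le_mono) simp
  then have "1 / s \<le> 1 / sqrt (s\<^sup>2 - r\<^sup>2)"
    using assms pos by (intro divide_left_mono) auto
  also have "\<dots> = (s\<^sup>2 - r\<^sup>2) powr (- 1 / 2)"
    using pos by (simp add: powr_minus powr_half_sqrt field_simps)
  finally have "2 / pi * (1 / s) \<le> 2 / pi * (s\<^sup>2 - r\<^sup>2) powr (- 1 / 2)"
    by (intro mult_left_mono) auto
  then show ?thesis
    using assms by (simp add: a2_def)
qed

text \<open>
  The constant is the inverse of \<open>1 / \<pi> \<cdot> 1 / 4\<close>: a lower bound for the mass of the outer half of the segment, times
  the loss in the truncated square from \<open>|x|\<close> to \<open>|x| / 2\<close>.
\<close>

lemma truncated_square_le_arcsine_kernel:
  fixes x :: "real ^ 'd"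
  shows "ennreal (min 1 ((norm x)\<^sup>2))
    \<le> ennreal (4 * pi) * (\<integral>\<^sup>+y. ennreal (min 1 ((norm y)\<^sup>2)) \<partial>arcsine_kernel x)"
proof (cases "x = 0")
  case True
  then show ?thesis by simp
next
  case False
  define s where "s = norm x"
  have s: "0 < s" using False by (simp add: s_def)
  \<comment> \<open>lower bound for the integrand on the outer half of the segment\<close>
  define c where "c = 2 / (pi * s) * (min 1 (s\<^sup>2) / 4)"
  have c: "0 \<le> c" using s by (simp add: c_def)
  have "ennreal c * indicator {s/2<..<s} r \<le> ennreal (a2 r s) * ennreal (min 1 (r\<^sup>2))" for r
  proof (cases "r \<in> {s/2<..<s}")
    case True
    then have r: "0 < r" "r < s" using s by auto
    have "(s/2)\<^sup>2 \<le> r\<^sup>2"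
      using True s by (intro power_mono) auto
    then have "min 1 (s\<^sup>2) / 4 \<le> min 1 (r\<^sup>2)"
      by (auto simp: power_divide min_def)
    then have "c \<le> a2 r s * min 1 (r\<^sup>2)"
      unfolding c_def using a2_ge[OF r] s by (intro mult_mono) (auto simp: a2_nonneg)
    then show ?thesis
      using True by (simp add: ennreal_mult'[symmetric] a2_nonneg ennreal_leI)
  next
    case False
    then show ?thesis by simp
  qed
  then have "(\<integral>\<^sup>+r. ennreal c * indicator {s/2<..<s} r \<partial>lborel)
      \<le> (\<integral>\<^sup>+y. ennreal (min 1 ((norm y)\<^sup>2)) \<partial>arcsine_kernel x)"
    unfolding arcsine_kernel_truncated_square s_def[symmetric] by (intro nn_integral_mono)
  moreover have "(\<integral>\<^sup>+r. ennreal c * indicator {s/2<..<s} r \<partial>lborel) = ennreal (c * (s / 2))"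
    using s c by (simp add: nn_integral_cmult_indicator ennreal_mult'[symmetric])
  ultimately have "ennreal (4 * pi) * ennreal (c * (s / 2))
      \<le> ennreal (4 * pi) * (\<integral>\<^sup>+y. ennreal (min 1 ((norm y)\<^sup>2)) \<partial>arcsine_kernel x)"
    by (intro mult_left_mono) auto
  moreover have "ennreal (4 * pi) * ennreal (c * (s / 2)) = ennreal (min 1 ((norm x)\<^sup>2))"
    using s c by (simp add: ennreal_mult'[symmetric] c_def s_def[symmetric])
  ultimately show ?thesis by simp
qed

section \<open>The domain\<close>

lemma arcsine2_in_levy_measures_iff:
  assumes \<nu>: "sets \<nu> = sets borel"
  shows "arcsine2 \<nu> \<in> levy_measures \<longleftrightarrow> (\<integral>\<^sup>+x. ennreal (min 1 ((norm x)\<^sup>2)) \<partial>\<nu>) < \<infinity>"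
proof -
  let ?f = "\<lambda>y. ennreal (min 1 ((norm y)\<^sup>2))"
  have eq: "(\<integral>\<^sup>+y. ?f y \<partial>arcsine2 \<nu>) = (\<integral>\<^sup>+x. (\<integral>\<^sup>+y. ?f y \<partial>arcsine_kernel x) \<partial>\<nu>)"
    by (intro nn_integral_arcsine2 \<nu> truncated_square_measurable)
  have meas: "(\<lambda>x. \<integral>\<^sup>+y. ?f y \<partial>arcsine_kernel x) \<in> borel_measurable \<nu>"
    unfolding arcsine_kernel_truncated_square measurable_cong_sets[OF \<nu> refl] by measurable
  have upper: "(\<integral>\<^sup>+y. ?f y \<partial>arcsine2 \<nu>) \<le> (\<integral>\<^sup>+x. ?f x \<partial>\<nu>)"
    unfolding eq by (intro nn_integral_mono arcsine_kernel_truncated_square_le)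
  have "(\<integral>\<^sup>+x. ?f x \<partial>\<nu>) \<le> (\<integral>\<^sup>+x. ennreal (4 * pi) * (\<integral>\<^sup>+y. ?f y \<partial>arcsine_kernel x) \<partial>\<nu>)"
    by (intro nn_integral_mono truncated_square_le_arcsine_kernel)
  then have lower: "(\<integral>\<^sup>+x. ?f x \<partial>\<nu>) \<le> ennreal (4 * pi) * (\<integral>\<^sup>+y. ?f y \<partial>arcsine2 \<nu>)"
    by (simp only: eq nn_integral_cmult[OF meas])
  have "(\<integral>\<^sup>+y. ?f y \<partial>arcsine2 \<nu>) < \<infinity> \<longleftrightarrow> (\<integral>\<^sup>+x. ?f x \<partial>\<nu>) < \<infinity>"
  proof
    assume "(\<integral>\<^sup>+y. ?f y \<partial>arcsine2 \<nu>) < \<infinity>"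
    then have "ennreal (4 * pi) * (\<integral>\<^sup>+y. ?f y \<partial>arcsine2 \<nu>) < \<infinity>"
      by (simp add: ennreal_mult_less_top)
    with lower show "(\<integral>\<^sup>+x. ?f x \<partial>\<nu>) < \<infinity>" by (rule le_less_trans)
  qed (rule le_less_trans[OF upper])
  then show ?thesis
    by (simp add: levy_measures_def emeasure_arcsine2_origin[OF \<nu>])
qed

theorem proposition3p3:
  shows "(arcsine2_domain :: (real ^ 'd) measure set) = levy_measures"
proof (rule set_eqI)
  fix \<nu> :: "(real ^ 'd) measure"
  have "\<nu> \<in> levy_measures \<longleftrightarrow> sets \<nu> = sets borel \<and> emeasure \<nu> {0} = 0
      \<and> (\<integral>\<^sup>+x. ennreal (min 1 ((norm x)\<^sup>2)) \<partial>\<nu>) < \<infinity>"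
    by (simp only: levy_measures_def mem_Collect_eq)
  then show "\<nu> \<in> arcsine2_domain \<longleftrightarrow> \<nu> \<in> levy_measures"
    using arcsine2_in_levy_measures_iff[of \<nu>] measure_space_arcsine2_fun[of \<nu>]
    by (auto simp only: arcsine2_domain_def mem_Collect_eq)
qed

end
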